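(* Let $k \geq 10$ and let $S_1, S_2, \ldots, S_k$ be binary squares, i.e., each $S_i = x_i x_i$ for some nonempty word $x_i \in \{0,1\}^+$. Then the concatenation $S_1 S_2 \cdots S_k$ contains a factor that is an overlap. Moreover, the bound $10$ is optimal: there exists an overlap-free binary word that is a concatenation of $9$ binary squares.
   Context: A word $w$ is a square if $w = xx$ for some nonempty word $x$. A word is an overlap if it has the form $axaxa$ where $a$ is a single letter and $x$ is a (possibly empty) word. A factor of $w$ is a word $y$ such that $w = xyz$ for some words $x, z$. A word is overlap-free if none of its factors is an overlap. *)

theory Defs
  imports "HOL-Library.Sublist"
begin

type_synonym binary_word = "bool list"

definition square_word :: "'a list \<Rightarrow> bool" where
  "square_word w \<longleftrightarrow> (\<exists>x. x \<noteq> [] \<and> w = x @ x)"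

definition overlap_word :: "'a list \<Rightarrow> bool" where
  "overlap_word w \<longleftrightarrow> (\<exists>a x. w = [a] @ x @ [a] @ x @ [a])"

definition overlap_free :: "'a list \<Rightarrow> bool" where
  "overlap_free w \<longleftrightarrow> (\<forall>y. sublist y w \<longrightarrow> \<not> overlap_word y)"

end

theory Submission
  imports Defs
begin

text \<open>
  Let \<open>c\<close> be a product of eight squares that stays overlap-free with one letter of context on each
  side. The positions at which a letter of \<open>c\<close> is repeated immediately all have the same parity. If
  they are even, then a square with a root of even length would form an overlap together with a
  neighbouring letter, and a root of odd length repeats no letter; so all roots are among 0, 1, 010
  and 101, and a finite search rules this out. If they are odd, then each square, starting at an
  even position, is the image of a shorter square under the Thue--Morse morphism; desubstituting
  yields a shorter product of eight squares, again overlap-free with context, and infinite descent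
  applies. Ten squares contain eight with context.
\<close>

section \<open>Overlaps\<close>

lemma overlap_word_iff: "overlap_word w \<longleftrightarrow> (\<exists>u. u \<noteq> [] \<and> w = u @ u @ [hd u])"
proof
  assume "overlap_word w"
  then obtain a x where "w = (a # x) @ (a # x) @ [hd (a # x)]"
    by (auto simp: overlap_word_def)
  then show "\<exists>u. u \<noteq> [] \<and> w = u @ u @ [hd u]" by blast
next
  assume "\<exists>u. u \<noteq> [] \<and> w = u @ u @ [hd u]"
  then obtain u where "u \<noteq> []" "w = u @ u @ [hd u]" by blast
  then have "w = [hd u] @ tl u @ [hd u] @ tl u @ [hd u]" by (cases u) auto
  then show "overlap_word w" unfolding overlap_word_def by blast
qed

lemma odd_length_overlap_word: "overlap_word w \<Longrightarrow> odd (length w)"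
  by (auto simp: overlap_word_def)

lemma overlap_word_square_hd: "u \<noteq> [] \<Longrightarrow> overlap_word (u @ u @ [hd u])"
  by (auto simp: overlap_word_iff)

lemma overlap_word_last_square: "u \<noteq> [] \<Longrightarrow> overlap_word (last u # u @ u)"
  using overlap_word_square_hd[of "last u # butlast u"]
  by (metis append_Cons append_assoc append_butlast_last_id append_Nil list.distinct(1) list.sel(1))

lemma ex_prefix_overlap_word_iff:
  "(\<exists>y. prefix y w \<and> overlap_word y) \<longleftrightarrow>
    (\<exists>p>0. 2 * p < length w \<and> take (Suc p) w = take (Suc p) (drop p w))"
proof
  assume "\<exists>y. prefix y w \<and> overlap_word y"
  then obtain u z where "u \<noteq> []" "w = u @ u @ [hd u] @ z"
    by (auto simp: overlap_word_iff prefix_def)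
  then show "\<exists>p>0. 2 * p < length w \<and> take (Suc p) w = take (Suc p) (drop p w)"
    by (intro exI[of _ "length u"]) (cases u; simp)
next
  assume "\<exists>p>0. 2 * p < length w \<and> take (Suc p) w = take (Suc p) (drop p w)"
  then obtain p where "0 < p" "2 * p < length w"
    and period: "take (Suc p) w = take (Suc p) (drop p w)" by blast
  define u where "u = take p w"
  have "u \<noteq> []" using \<open>0 < p\<close> \<open>2 * p < length w\<close> by (auto simp: u_def)
  have "hd u = w ! p"
    using arg_cong[OF period, of hd] \<open>0 < p\<close> \<open>2 * p < length w\<close>
    by (simp add: u_def hd_take hd_drop_conv_nth)
  then have "take (Suc p) w = u @ [hd u]"
    using \<open>2 * p < length w\<close> by (simp add: u_def take_Suc_conv_app_nth)
  then have "w = (u @ u @ [hd u]) @ drop (Suc p) (drop p w)"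
    by (metis append_assoc append_take_drop_id period u_def)
  then show "\<exists>y. prefix y w \<and> overlap_word y"
    using overlap_word_square_hd[OF \<open>u \<noteq> []\<close>] by (metis prefixI)
qed

lemma overlap_free_sublist: "overlap_free w \<Longrightarrow> sublist v w \<Longrightarrow> overlap_free v"
  unfolding overlap_free_def by (meson sublist_order.order.trans)

lemma not_overlap_word_if_overlap_free_append: "overlap_free (P @ y @ Q) \<Longrightarrow> \<not> overlap_word y"
  by (simp add: overlap_free_def)

lemma overlap_free_code [code]:
  "overlap_free [] \<longleftrightarrow> True"
  "overlap_free (x # xs) \<longleftrightarrow>
    list_all (\<lambda>p. take (Suc p) (x # xs) \<noteq> take (Suc p) (drop p (x # xs)))
      [1..<Suc (length xs div 2)] \<and> overlap_free xs"
proof -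
  show "overlap_free [] \<longleftrightarrow> True" by (simp add: overlap_free_def overlap_word_def)
  have "overlap_free (x # xs) \<longleftrightarrow> \<not> (\<exists>y. prefix y (x # xs) \<and> overlap_word y) \<and> overlap_free xs"
    unfolding overlap_free_def sublist_Cons_right by blast
  moreover have "p \<in> set [1..<Suc (length xs div 2)] \<longleftrightarrow> 0 < p \<and> 2 * p < length (x # xs)" for p
    by auto
  ultimately show "overlap_free (x # xs) \<longleftrightarrow>
    list_all (\<lambda>p. take (Suc p) (x # xs) \<noteq> take (Suc p) (drop p (x # xs)))
      [1..<Suc (length xs div 2)] \<and> overlap_free xs"
    unfolding ex_prefix_overlap_word_iff list_all_iff by blast
qed

section \<open>Doubled letters\<close>

definition doubles :: "'a list \<Rightarrow> nat set" where
  "doubles w = {i. Suc i < length w \<and> w ! i = w ! Suc i}"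

lemma doubles_append_append:
  "i \<in> doubles v \<Longrightarrow> length u + i \<in> doubles (u @ v @ z)"
  by (auto simp: doubles_def nth_append)

lemma last_neq_hd_if_even_doubles:
  assumes "\<forall>i\<in>doubles (u @ v). even i" "even (length u)" "u \<noteq> []" "v \<noteq> []"
  shows "last u \<noteq> hd v"
proof
  assume "last u = hd v"
  then have "length u - 1 \<in> doubles (u @ v)"
    using assms(3,4) by (cases u rule: rev_cases; cases v) (simp_all add: doubles_def nth_append)
  then have "even (length u - 1)" using assms(1) by blast
  then show False using assms(2,3) by simp
qed

lemma distinct_adj_if_doubles_empty: "doubles w = {} \<Longrightarrow> distinct_adj w"
  by (auto simp: doubles_def distinct_adj_conv_nth)

lemma overlap_free_window:
  assumes "overlap_free w" "i + n \<le> length w"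
  shows "overlap_free (map (\<lambda>k. w ! (i + k)) [0..<n])"
proof -
  have "map (\<lambda>k. w ! (i + k)) [0..<n] = take n (drop i w)"
    using assms(2) by (intro nth_equalityI) simp_all
  then show ?thesis
    using assms(1) by (metis overlap_free_sublist sublist_drop sublist_take)
qed

lemma not_overlap_free_cube: "\<not> overlap_free [x, x, x]"
  by (simp add: overlap_free_code)

lemma letters_after_double_if_overlap_free:
  "\<forall>y x p q r s. overlap_free [y, x, x, p, q, r, s :: bool] \<longrightarrow> q \<noteq> r \<and> (p = q \<or> r = s)"
  by code_simp

lemma not_distinct_adj_if_overlap_free_5:
  "\<forall>p q r s t. overlap_free [p, q, r, s, t :: bool] \<longrightarrow> \<not> distinct_adj [p, q, r, s, t]"
  by code_simp

lemma doubles_after_double: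
  fixes c :: binary_word
  assumes free: "overlap_free (a # c @ [b])" and double: "i \<in> doubles c"
  shows "i + 1 \<notin> doubles c" "i + 3 \<notin> doubles c"
    and "i + 5 < length c \<Longrightarrow> i + 2 \<in> doubles c \<or> i + 4 \<in> doubles c"
proof -
  define w where "w = a # c @ [b]"
  have nth_w: "w ! Suc k = c ! k" if "k < length c" for k
    using that by (simp add: w_def nth_append)
  have length_w: "length w = length c + 2" by (simp add: w_def)
  have window: "overlap_free (map (\<lambda>k. w ! (j + k)) [0..<n])" if "j + n \<le> length w" for j n
    using overlap_free_window[OF free] that by (simp add: w_def)
  note window_simps = length_w nth_w doubles_def upt_conv_Cons eval_nat_numeral
  show "i + 1 \<notin> doubles c"
    using window[of "i + 1" 3] double not_overlap_free_cube[of "c ! i"]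
    by (auto simp: window_simps)
  have "overlap_free [w ! i, c ! i, c ! i, c ! (i + 2), c ! (i + 3), c ! (i + 4), w ! (i + 6)]"
    if "i + 4 < length c"
    using window[of i 7] that double by (simp add: window_simps)
  then have letters: "c ! (i + 3) \<noteq> c ! (i + 4)"
      "c ! (i + 2) = c ! (i + 3) \<or> c ! (i + 4) = w ! (i + 6)" if "i + 4 < length c"
    using letters_after_double_if_overlap_free that by blast+
  show "i + 3 \<notin> doubles c"
    using letters(1) by (auto simp: doubles_def add.commute)
  show "i + 2 \<in> doubles c \<or> i + 4 \<in> doubles c" if "i + 5 < length c"
    using letters(2) that nth_w[of "i + 5"] by (simp add: doubles_def eval_nat_numeral)
qed

lemma even_distance_doubles:
  fixes c :: binary_word
  assumes free: "overlap_free (a # c @ [b])"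
  shows "i \<in> doubles c \<Longrightarrow> i + d \<in> doubles c \<Longrightarrow> even d"
proof (induction d arbitrary: i rule: less_induct)
  case (less d)
  note after = doubles_after_double[OF free \<open>i \<in> doubles c\<close>]
  show ?case
  proof (cases "d < 5")
    case True
    moreover have "d \<noteq> 1" "d \<noteq> 3" using less.prems(2) after by auto
    ultimately have "d = 0 \<or> d = 2 \<or> d = 4" by linarith
    then show ?thesis by auto
  next
    case False
    then have "i + 5 < length c" using less.prems(2) by (simp add: doubles_def)
    with after(3) obtain e where "e \<in> {2, 4}" and next_double: "i + e \<in> doubles c" by blast
    then have "0 < e" "e < d" "even e" using False by auto
    then have "i + e + (d - e) \<in> doubles c" using less.prems(2) by simp
    then have "even (d - e)" using less.IH[of "d - e" "i + e"] next_double \<open>0 < e\<close> \<open>e < d\<close> by simp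
    then show ?thesis using \<open>even e\<close> \<open>e < d\<close> by simp
  qed
qed

lemma doubles_parity_cases:
  fixes c :: binary_word
  assumes "overlap_free (a # c @ [b])"
  obtains (even) "\<forall>i\<in>doubles c. even i" | (odd) "\<forall>i\<in>doubles c. odd i"
proof -
  have "even i \<longleftrightarrow> even j" if "i \<in> doubles c" "j \<in> doubles c" for i j
    using even_distance_doubles[OF assms, of i "j - i"]
      even_distance_doubles[OF assms, of j "i - j"] that by (cases "i \<le> j") auto
  then show thesis using that by blast
qed

section \<open>The Thue--Morse morphism\<close>

definition thue_morse :: "binary_word \<Rightarrow> binary_word" where
  "thue_morse w = concat (map (\<lambda>a. [a, \<not> a]) w)"

lemma thue_morse_simps [simp]:
  "thue_morse [] = []"
  "thue_morse (a # w) = a # (\<not> a) # thue_morse w"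
  "thue_morse (v @ w) = thue_morse v @ thue_morse w"
  by (simp_all add: thue_morse_def)

lemma length_thue_morse [simp]: "length (thue_morse w) = 2 * length w"
  by (induction w) simp_all

lemma thue_morse_eq_iff [simp]: "thue_morse v = thue_morse w \<longleftrightarrow> v = w"
  by (induction v w rule: list_induct2') auto

lemma count_list_thue_morse: "count_list (thue_morse w) True = length w"
  by (induction w) auto

lemma thue_morse_concat: "thue_morse (concat ws) = concat (map thue_morse ws)"
  by (induction ws) simp_all

lemma range_thue_morse_if_odd_doubles:
  assumes "even (length w)" "\<forall>i\<in>doubles w. odd i"
  shows "w \<in> range thue_morse"
  using assms
proof (induction w rule: induct_list012)
  case 1
  show ?case by (metis rangeI thue_morse_simps(1))
next
  case (3 a b w)
  have "a \<noteq> b"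
  proof
    assume "a = b"
    then have "0 \<in> doubles (a # b # w)" by (simp add: doubles_def)
    then show False using "3.prems" by auto
  qed
  have "\<forall>i\<in>doubles w. odd i"
    using "3.prems"(2) doubles_append_append[of _ w "[a, b]" "[]"] by fastforce
  then obtain v where "w = thue_morse v" using "3.IH"(1) "3.prems"(1) by auto
  then have "a # b # w = thue_morse (a # v)" using \<open>a \<noteq> b\<close> by auto
  then show ?case by (rule range_eqI)
qed simp

lemma square_word_thue_morseD:
  assumes "square_word (thue_morse w)"
  shows "square_word w"
proof -
  obtain x where "x \<noteq> []" and image: "thue_morse w = x @ x"
    using assms by (auto simp: square_word_def)
  \<comment> \<open>In an image of the morphism half of the letters are 1, so \<open>x\<close> has even length.\<close>
  define n where "n = count_list x True"
  have "length w = 2 * n" using count_list_thue_morse[of w] by (simp add: image n_def)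
  moreover have "length w = length x" using arg_cong[OF image, of length] by simp
  moreover have "thue_morse (take n w) @ thue_morse (drop n w) = x @ x"
    by (simp flip: image thue_morse_simps(3))
  ultimately have halves: "thue_morse (take n w) = x" "thue_morse (drop n w) = x"
    by (simp_all add: append_eq_append_conv)
  then have "thue_morse (take n w) = thue_morse (drop n w)" by simp
  then have "take n w = drop n w" by (simp only: thue_morse_eq_iff)
  then have "w = take n w @ take n w" by (metis append_take_drop_id)
  moreover have "take n w \<noteq> []" using \<open>x \<noteq> []\<close> halves(1) thue_morse_simps(1) by metis
  ultimately show ?thesis unfolding square_word_def by blast
qed

lemma sublist_if_append_eq_Cons_snoc:
  assumes "p @ y @ q = a # w @ [b]" "p \<noteq> []" "q \<noteq> []"
  shows "sublist y w"
  using assms by (cases p; cases q rule: rev_cases) auto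

lemma overlap_word_thue_morse:
  assumes "overlap_word y"
  shows "overlap_word (butlast (thue_morse y))" "overlap_word (tl (thue_morse y))"
proof -
  obtain a x where y_eq: "y = (a # x) @ (a # x) @ [a]" using assms by (auto simp: overlap_word_def)
  have "butlast (thue_morse y) =
      [a] @ ((\<not> a) # thue_morse x) @ [a] @ ((\<not> a) # thue_morse x) @ [a]"
    by (simp add: y_eq butlast_append)
  then show "overlap_word (butlast (thue_morse y))" unfolding overlap_word_def by blast
  have "tl (thue_morse y) =
      [\<not> a] @ (thue_morse x @ [a]) @ [\<not> a] @ (thue_morse x @ [a]) @ [\<not> a]"
    by (simp add: y_eq)
  then show "overlap_word (tl (thue_morse y))" unfolding overlap_word_def by blast
qed

lemma overlap_free_if_overlap_free_thue_morse:
  assumes free: "overlap_free (a # thue_morse v @ [b])" and "even (length v)"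
  shows "overlap_free ((\<not> a) # v @ [b])"
  unfolding overlap_free_def
proof (intro allI impI notI)
  fix y
  assume "sublist y ((\<not> a) # v @ [b])" "overlap_word y"
  then obtain P Q where factorisation: "(\<not> a) # v @ [b] = P @ y @ Q" by (auto simp: sublist_def)
  define z where "z = thue_morse y"
  have "z \<noteq> []" using \<open>overlap_word y\<close> by (auto simp: z_def overlap_word_def)
  \<comment> \<open>The image of the whole word extends the given overlap-free word by one letter on each side.\<close>
  have image: "thue_morse P @ z @ thue_morse Q = (\<not> a) # (a # thue_morse v @ [b]) @ [\<not> b]"
    using arg_cong[OF factorisation, of thue_morse] by (simp add: z_def)
  have "P \<noteq> [] \<or> Q \<noteq> []"
    using odd_length_overlap_word[OF \<open>overlap_word y\<close>] \<open>even (length v)\<close> factorisation by auto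
  then obtain z' where "overlap_word z'" "sublist z' (a # thue_morse v @ [b])"
  proof
    assume "P \<noteq> []"
    then have "thue_morse P \<noteq> []" by (cases P) simp_all
    have "thue_morse P @ butlast z @ (last z # thue_morse Q) =
        (\<not> a) # (a # thue_morse v @ [b]) @ [\<not> b]"
      using image \<open>z \<noteq> []\<close> by (cases z rule: rev_cases) simp_all
    then have "sublist (butlast z) (a # thue_morse v @ [b])"
      by (rule sublist_if_append_eq_Cons_snoc) (simp_all add: \<open>thue_morse P \<noteq> []\<close>)
    then show thesis
      using that overlap_word_thue_morse(1)[OF \<open>overlap_word y\<close>] by (simp add: z_def)
  next
    assume "Q \<noteq> []"
    then have "thue_morse Q \<noteq> []" by (cases Q) simp_all
    have "(thue_morse P @ [hd z]) @ tl z @ thue_morse Q =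
        (\<not> a) # (a # thue_morse v @ [b]) @ [\<not> b]"
      using image \<open>z \<noteq> []\<close> by (cases z) simp_all
    then have "sublist (tl z) (a # thue_morse v @ [b])"
      by (rule sublist_if_append_eq_Cons_snoc) (simp_all add: \<open>thue_morse Q \<noteq> []\<close>)
    then show thesis
      using that overlap_word_thue_morse(2)[OF \<open>overlap_word y\<close>] by (simp add: z_def)
  qed
  then show False using free by (auto simp: overlap_free_def)
qed

section \<open>Products of squares\<close>

lemma even_length_square_word: "square_word S \<Longrightarrow> even (length S)"
  by (auto simp: square_word_def)

lemma even_length_concat_squares:
  "\<forall>S\<in>set Ss. square_word S \<Longrightarrow> even (length (concat Ss))"
  by (induction Ss) (auto simp: even_length_square_word)

lemma concat_squares_split:
  assumes "S \<in> set Ss" "\<forall>S\<in>set Ss. square_word S"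
  obtains P Q where "concat Ss = P @ S @ Q" "even (length P)"
    "2 \<le> length Ss \<Longrightarrow> P \<noteq> [] \<or> Q \<noteq> []"
proof -
  obtain Ps Qs where Ss_eq: "Ss = Ps @ S # Qs" using assms(1) by (meson split_list)
  then have squares: "\<forall>R\<in>set Ps \<union> set Qs. square_word R" using assms(2) by simp
  have "concat Ps \<noteq> [] \<or> concat Qs \<noteq> []" if "2 \<le> length Ss"
  proof -
    have "Ps \<noteq> [] \<or> Qs \<noteq> []" using that Ss_eq by auto
    then show ?thesis using squares by (cases Ps; cases Qs) (auto simp: square_word_def)
  qed
  moreover have "even (length (concat Ps))"
    using squares by (intro even_length_concat_squares) blast
  ultimately show thesis using that[of "concat Ps" "concat Qs"] Ss_eq by simp
qed

lemma concat_squares_eq_thue_morse: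
  fixes Ss :: "binary_word list"
  assumes squares: "\<forall>S\<in>set Ss. square_word S" and "\<forall>i\<in>doubles (concat Ss). odd i"
  obtains Ts where "Ss = map thue_morse Ts" "\<forall>T\<in>set Ts. square_word T"
proof -
  have "S \<in> range thue_morse" if "S \<in> set Ss" for S
  proof -
    obtain P Q where "concat Ss = P @ S @ Q" "even (length P)"
      using concat_squares_split[OF \<open>S \<in> set Ss\<close> squares] .
    then have "\<forall>i\<in>doubles S. odd i"
      using assms(2) doubles_append_append[of _ S P Q] by fastforce
    moreover have "even (length S)" using squares that even_length_square_word by blast
    ultimately show ?thesis by (intro range_thue_morse_if_odd_doubles)
  qed
  then obtain Ts where Ss_eq: "Ss = map thue_morse Ts" by (metis ex_map_conv image_iff)
  then have "\<forall>T\<in>set Ts. square_word T" using squares square_word_thue_morseD by auto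
  with Ss_eq show thesis by (rule that)
qed

lemma odd_length_root_if_even_doubles:
  fixes x :: binary_word
  assumes free: "overlap_free (P @ x @ x @ Q)"
    and "even (length P)" "x \<noteq> []" "P \<noteq> [] \<or> Q \<noteq> []" "\<forall>i\<in>doubles (P @ x @ x @ Q). even i"
  shows "odd (length x)"
proof
  assume "even (length x)"
  then have "last x \<noteq> hd x"
    using last_neq_hd_if_even_doubles[of "P @ x" "x @ Q"] assms(2-) by simp
  from \<open>P \<noteq> [] \<or> Q \<noteq> []\<close> show False
  proof
    assume "P \<noteq> []"
    then have "last P \<noteq> hd x"
      using last_neq_hd_if_even_doubles[of P "x @ x @ Q"] assms(2-) by simp
    then have "last P = last x" using \<open>last x \<noteq> hd x\<close> by simp
    then have "P @ x @ x @ Q = butlast P @ (last x # x @ x) @ Q"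
      using \<open>P \<noteq> []\<close> by (cases P rule: rev_cases) simp_all
    then have "\<not> overlap_word (last x # x @ x)"
      using free not_overlap_word_if_overlap_free_append by metis
    then show False using overlap_word_last_square[OF \<open>x \<noteq> []\<close>] by blast
  next
    assume "Q \<noteq> []"
    then have "last x \<noteq> hd Q"
      using last_neq_hd_if_even_doubles[of "P @ x @ x" Q] assms(2-) by simp
    then have "hd Q = hd x" using \<open>last x \<noteq> hd x\<close> by simp
    then have "P @ x @ x @ Q = P @ (x @ x @ [hd x]) @ tl Q"
      using \<open>Q \<noteq> []\<close> by (cases Q) simp_all
    then have "\<not> overlap_word (x @ x @ [hd x])"
      using free not_overlap_word_if_overlap_free_append by metis
    then show False using overlap_word_square_hd[OF \<open>x \<noteq> []\<close>] by blast
  qed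
qed

lemma doubles_root_empty:
  assumes "odd (length x)" "\<forall>i\<in>doubles (x @ x). even i"
  shows "doubles x = {}"
proof -
  have "i \<notin> doubles x" for i
  proof
    assume "i \<in> doubles x"
    then have "i \<in> doubles (x @ x)" "length x + i \<in> doubles (x @ x)"
      using doubles_append_append[of i x "[]" x] doubles_append_append[of i x x "[]"] by simp_all
    then have "even i" "even (length x + i)" using assms(2) by blast+
    then show False using assms(1) by simp
  qed
  then show ?thesis by blast
qed

lemma length_less_5_if_distinct_adj:
  fixes x :: binary_word
  assumes "overlap_free x" "distinct_adj x"
  shows "length x < 5"
proof (rule ccontr)
  assume "\<not> length x < 5"
  then obtain p q r s t z where x_eq: "x = [p, q, r, s, t] @ z"
    by (auto simp: not_less numeral_eq_Suc Suc_le_length_iff)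
  have "overlap_free [p, q, r, s, t]"
    using assms(1) unfolding x_eq by (rule overlap_free_sublist) (rule sublist_append_rightI)
  moreover have "distinct_adj [p, q, r, s, t]" using assms(2) by (simp add: x_eq)
  ultimately show False using not_distinct_adj_if_overlap_free_5 by blast
qed

definition odd_roots :: "binary_word list" where
  "odd_roots = [[False], [True], [False, True, False], [True, False, True]]"

lemma in_odd_roots_if_distinct_adj:
  fixes x :: binary_word
  assumes "overlap_free x" "distinct_adj x" "odd (length x)"
  shows "x \<in> set odd_roots"
proof -
  have "length x = 1 \<or> length x = 3"
    using length_less_5_if_distinct_adj[OF assms(1,2)] \<open>odd (length x)\<close> by presburger
  then show ?thesis using \<open>distinct_adj x\<close>
    by (auto simp: odd_roots_def numeral_eq_Suc length_Suc_conv)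
qed

definition odd_root_squares :: "binary_word list" where
  "odd_root_squares = map (\<lambda>x. x @ x) odd_roots"

lemma odd_root_squares_if_even_doubles:
  fixes Ss :: "binary_word list"
  assumes squares: "\<forall>S\<in>set Ss. square_word S" and "2 \<le> length Ss"
    and free: "overlap_free (concat Ss)" and doubles: "\<forall>i\<in>doubles (concat Ss). even i"
  shows "set Ss \<subseteq> set odd_root_squares"
proof
  fix S assume "S \<in> set Ss"
  then obtain x where "x \<noteq> []" and S_eq: "S = x @ x" using squares by (auto simp: square_word_def)
  obtain P Q where split: "concat Ss = P @ S @ Q" "even (length P)" "P \<noteq> [] \<or> Q \<noteq> []"
    using concat_squares_split[OF \<open>S \<in> set Ss\<close> squares] \<open>2 \<le> length Ss\<close> by blast
  have "odd (length x)"
    using odd_length_root_if_even_doubles[of P x Q] free doubles split \<open>x \<noteq> []\<close> S_eq by simp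
  moreover have "\<forall>i\<in>doubles S. even i"
    using doubles split doubles_append_append[of _ S P Q] by fastforce
  ultimately have "distinct_adj x"
    unfolding S_eq by (intro distinct_adj_if_doubles_empty doubles_root_empty)
  moreover have "overlap_free S"
    using free unfolding split(1) by (rule overlap_free_sublist) (rule sublist_appendI)
  then have "overlap_free x"
    unfolding S_eq by (rule overlap_free_sublist) (rule sublist_append_leftI)
  ultimately have "x \<in> set odd_roots" using \<open>odd (length x)\<close> by (intro in_odd_roots_if_distinct_adj)
  then show "S \<in> set odd_root_squares" by (simp add: odd_root_squares_def S_eq)
qed

fun overlap_free_products :: "nat \<Rightarrow> binary_word list" where
  "overlap_free_products 0 = [[False], [True]]"
| "overlap_free_products (Suc n) =
    filter overlap_free [s @ v. v \<leftarrow> overlap_free_products n, s \<leftarrow> odd_root_squares]"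

lemma concat_in_overlap_free_products:
  assumes "set Ss \<subseteq> set odd_root_squares" "overlap_free (concat Ss @ [b])"
  shows "concat Ss @ [b] \<in> set (overlap_free_products (length Ss))"
  using assms
proof (induction Ss)
  case (Cons S Ss)
  then have "overlap_free (concat Ss @ [b])" by (auto elim: overlap_free_sublist)
  with Cons show ?case by auto
qed (cases b; simp)

lemma not_overlap_free_Cons_products_8:
  "list_all (\<lambda>v. \<not> overlap_free (False # v) \<and> \<not> overlap_free (True # v))
    (overlap_free_products 8)"
  by code_simp

lemma not_overlap_free_eight_odd_root_squares:
  assumes "set Ss \<subseteq> set odd_root_squares" "length Ss = 8"
  shows "\<not> overlap_free (a # concat Ss @ [b])"
proof
  assume free: "overlap_free (a # concat Ss @ [b])"
  then have "overlap_free (concat Ss @ [b])"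
    by (rule overlap_free_sublist) (simp add: sublist_Cons_right)
  then have "concat Ss @ [b] \<in> set (overlap_free_products 8)"
    using concat_in_overlap_free_products assms by metis
  then show False
    using not_overlap_free_Cons_products_8 free by (cases a) (simp_all add: list_all_iff)
qed

lemma not_overlap_free_eight_squares:
  fixes Ss :: "binary_word list"
  assumes "length Ss = 8" "\<forall>S\<in>set Ss. square_word S"
  shows "\<not> overlap_free (a # concat Ss @ [b])"
  using assms
proof (induction "length (concat Ss)" arbitrary: Ss a rule: less_induct)
  case less
  show ?case
  proof
    assume free: "overlap_free (a # concat Ss @ [b])"
    then show False
    proof (cases rule: doubles_parity_cases)
      case even
      moreover have "overlap_free (concat Ss)"
        using free by (rule overlap_free_sublist) (metis append_Cons append_Nil sublist_appendI)
      ultimately have "set Ss \<subseteq> set odd_root_squares"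
        using odd_root_squares_if_even_doubles less.prems by simp
      then show False using not_overlap_free_eight_odd_root_squares less.prems(1) free by blast
    next
      case odd
      then obtain Ts where Ss_eq: "Ss = map thue_morse Ts"
        and squares: "\<forall>T\<in>set Ts. square_word T"
        using concat_squares_eq_thue_morse less.prems(2) by blast
      then have image: "concat Ss = thue_morse (concat Ts)" by (simp add: thue_morse_concat)
      have "even (length (concat Ts))" using squares by (rule even_length_concat_squares)
      with free have "overlap_free ((\<not> a) # concat Ts @ [b])"
        unfolding image by (rule overlap_free_if_overlap_free_thue_morse)
      moreover have "concat Ts \<noteq> []"
        using Ss_eq squares less.prems(1) by (cases Ts) (auto simp: square_word_def)
      then have "length (concat Ts) < length (concat Ss)" by (simp add: image)
      ultimately show False using less.hyps Ss_eq squares less.prems(1) by simp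
    qed
  qed
qed

lemma not_overlap_free_concat_squares:
  fixes Ss :: "binary_word list"
  assumes "10 \<le> length Ss" and squares: "\<forall>S\<in>set Ss. square_word S"
  shows "\<not> overlap_free (concat Ss)"
proof -
  obtain S Rs where "Ss = S # Rs" using assms(1) by (cases Ss) auto
  moreover from this obtain T Us where "drop 8 Rs = T # Us"
    using assms(1) by (cases "drop 8 Rs") auto
  ultimately have Ss_eq: "Ss = S # take 8 Rs @ T # Us" by (metis append_take_drop_id)
  then have "S \<noteq> []" "T \<noteq> []" using squares by (auto simp: square_word_def)
  then have "concat Ss = butlast S @ (last S # concat (take 8 Rs) @ [hd T]) @ (tl T @ concat Us)"
    by (subst Ss_eq) simp
  moreover have "length (take 8 Rs) = 8" using assms(1) \<open>Ss = S # Rs\<close> by simp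
  then have "\<not> overlap_free (last S # concat (take 8 Rs) @ [hd T])"
    by (rule not_overlap_free_eight_squares) (use squares Ss_eq in auto)
  ultimately show ?thesis by (metis overlap_free_sublist sublist_appendI)
qed

definition nine_squares :: "binary_word list" where
  "nine_squares = map (\<lambda>x. x @ x)
    [[False, False, True], [True, False], [False, True], [True, False],
     [False, True, True, False, False, True],
     [True, False], [False, True], [True, False], [False, True, True]]"

lemma square_word_nine_squares: "\<forall>S\<in>set nine_squares. square_word S"
proof
  fix S assume "S \<in> set nine_squares"
  then obtain x where "x \<noteq> []" "S = x @ x"
    unfolding nine_squares_def set_map by (elim imageE) auto
  then show "square_word S" by (auto simp: square_word_def)
qed

lemma overlap_free_nine_squares: "overlap_free (concat nine_squares)"
  by code_simp

theorem theorem1: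
  shows "(\<forall>k \<ge> 10. \<forall>Ss :: binary_word list.
            length Ss = k \<and> (\<forall>S \<in> set Ss. square_word S) \<longrightarrow>
            (\<exists>y. sublist y (concat Ss) \<and> overlap_word y)) \<and>
         (\<exists>Ss :: binary_word list.
            length Ss = 9 \<and> (\<forall>S \<in> set Ss. square_word S) \<and> overlap_free (concat Ss))"
proof (intro conjI allI impI)
  fix k :: nat and Ss :: "binary_word list"
  assume "10 \<le> k" "length Ss = k \<and> (\<forall>S\<in>set Ss. square_word S)"
  then have "\<not> overlap_free (concat Ss)" using not_overlap_free_concat_squares by simp
  then show "\<exists>y. sublist y (concat Ss) \<and> overlap_word y" by (auto simp: overlap_free_def)
next
  have "length nine_squares = 9" by (simp add: nine_squares_def)
  then show "\<exists>Ss :: binary_word list.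
      length Ss = 9 \<and> (\<forall>S\<in>set Ss. square_word S) \<and> overlap_free (concat Ss)"
    using square_word_nine_squares overlap_free_nine_squares by blast
qed

end
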